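(* Let $t_1=1$ and $t_{k+1}=\frac{1+\sqrt{1+4t_k^2}}{2}$ for $k\ge1$. Suppose that Assumption $A_1$ (local error bound condition) holds, let $(x_k)$ be generated by the Inertial Forward-Backward algorithm with this $(t_k)$, and let $x_*\in X$. Then, as $k\to\infty$: 1) $F(x_k)-F(x_* )=o\left(\frac{1}{k^6}\right)$ and $\|x_k-x_{k-1}\|=O\left(\frac{1}{k^3}\right)$. 2) $(x_k)$ converges (in norm) to some $\bar x\in X$, with rate $\|x_k-\bar x\|=O\left(\frac{1}{k^2}\right)$.
   Context: Setting. $H$ is a real Hilbert space; $f:H\to\mathbb{R}$ is convex and continuously differentiable with $L_f$-Lipschitz continuous gradient ($L_f>0$); $g:H\to\mathbb{R}\cup\{+\infty\}$ is proper, lower semicontinuous and convex; $F:=f+g$. It is assumed that $X:=\arg\min F\neq\emptyset$, and $F_*:=\min F=F(x_* )$ for $x_*\in X$. For $\lambda>0$, $\mathrm{prox}_{\lambda g}(z):=\arg\min_{x\in H}\{g(x)+\frac{1}{2\lambda}\|x-z\|^2\}$ and $T_\lambda(x):=\mathrm{prox}_{\lambda g}(x-\lambda\nabla f(x))$. Inertial Forward-Backward algorithm (IFB). Fix $\mu\in(0,1)$, $\lambda=\mu/L_f$, a starting point $x_0\in H$, $y_1=x_0$, and the sequence $(t_k)_{k\ge1}$ (with $t_1=1$). For $k\ge1$: $x_k=T_\lambda(y_k)$ and $y_{k+1}=x_k+\gamma_k(x_k-x_{k-1})$, where $\gamma_k=\frac{t_k-1}{t_{k+1}}$. Assumption $A_1$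 (local error bound condition): for any $\xi\ge F_*$ there exist $\varepsilon>0$ and $\bar\tau>0$ such that $\mathrm{dist}(x,X)\le\bar\tau\,\|T_{1/L_f}(x)-x\|$ whenever $\|T_{1/L_f}(x)-x\|<\varepsilon$ and $F(x)\le\xi$. *)

theory Defs
  imports "HOL-Analysis.Analysis" "HOL-Library.Landau_Symbols"
begin

text \<open>A real Hilbert space is a type of sort \<open>{real_inner, complete_space}\<close>. A function into
  the extended half-line (no value \<open>-\<infinity>\<close>) is a function into \<^typ>\<open>ereal\<close> which is
  \<open>proper_fun\<close>.\<close>

definition proper_fun :: "('a \<Rightarrow> ereal) \<Rightarrow> bool" where
  "proper_fun g \<longleftrightarrow> (\<forall>x. g x \<noteq> -\<infinity>) \<and> (\<exists>x. g x \<noteq> \<infinity>)"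

definition lsc_fun :: "('a::topological_space \<Rightarrow> ereal) \<Rightarrow> bool" where
  "lsc_fun g \<longleftrightarrow> (\<forall>x. g x \<le> Liminf (at x) g)"

text \<open>Analogue of \<^const>\<open>convex_on\<close> for extended values. In \<^typ>\<open>ereal\<close> one has
  \<open>0 * \<infinity> = 0\<close>, so the cases \<open>u = 0\<close> and \<open>v = 0\<close> impose nothing.\<close>

definition convex_fun :: "('a::real_vector \<Rightarrow> ereal) \<Rightarrow> bool" where
  "convex_fun g \<longleftrightarrow> (\<forall>x y. \<forall>u\<ge>0. \<forall>v\<ge>0. u + v = 1 \<longrightarrow>
      g (u *\<^sub>R x + v *\<^sub>R y) \<le> ereal u * g x + ereal v * g y)"

definition objective :: "('a \<Rightarrow> real) \<Rightarrow> ('a \<Rightarrow> ereal) \<Rightarrow> 'a \<Rightarrow> ereal" where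
  "objective f g x = ereal (f x) + g x"

definition minimizers :: "('a \<Rightarrow> ereal) \<Rightarrow> 'a set" where
  "minimizers F = {x. is_arg_min F (\<lambda>_. True) x}"

text \<open>\<^const>\<open>arg_min\<close> picks some minimizer; for proper, lower semicontinuous, convex \<open>g\<close> and
  \<open>lam > 0\<close> on a Hilbert space the minimizer exists and is unique.\<close>

definition prox :: "real \<Rightarrow> ('a::real_inner \<Rightarrow> ereal) \<Rightarrow> 'a \<Rightarrow> 'a" where
  "prox lam g z = arg_min (\<lambda>x. g x + ereal (1 / (2 * lam) * (norm (x - z))\<^sup>2)) (\<lambda>_. True)"

text \<open>The forward-backward operator; \<open>df\<close> is the gradient of the smooth part.\<close>

definition fb_step :: "('a::real_inner \<Rightarrow> 'a) \<Rightarrow> ('a \<Rightarrow> ereal) \<Rightarrow> real \<Rightarrow> 'a \<Rightarrow> 'a" where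
  "fb_step df g lam x = prox lam g (x - lam *\<^sub>R df x)"

definition local_error_bound ::
  "('a::real_inner \<Rightarrow> real) \<Rightarrow> ('a \<Rightarrow> 'a) \<Rightarrow> ('a \<Rightarrow> ereal) \<Rightarrow> real \<Rightarrow> bool" where
  "local_error_bound f df g L \<longleftrightarrow>
    (\<forall>\<xi>::real. (INF z. objective f g z) \<le> ereal \<xi> \<longrightarrow>
      (\<exists>\<epsilon>>0. \<exists>\<tau>>0. \<forall>x.
        norm (fb_step df g (1 / L) x - x) < \<epsilon> \<and> objective f g x \<le> ereal \<xi> \<longrightarrow>
        infdist x (minimizers (objective f g)) \<le> \<tau> * norm (fb_step df g (1 / L) x - x)))"

text \<open>The value \<open>y 0\<close> is not part of the algorithm and is left unconstrained, as is \<open>t 0\<close>.\<close>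

definition inertial_fb ::
  "('a::real_inner \<Rightarrow> 'a) \<Rightarrow> ('a \<Rightarrow> ereal) \<Rightarrow> real \<Rightarrow> (nat \<Rightarrow> real) \<Rightarrow>
    (nat \<Rightarrow> 'a) \<Rightarrow> (nat \<Rightarrow> 'a) \<Rightarrow> bool" where
  "inertial_fb df g lam t x y \<longleftrightarrow>
    y 1 = x 0 \<and>
    (\<forall>k\<ge>1. x k = fb_step df g lam (y k) \<and>
      y (k + 1) = x k + ((t k - 1) / t (k + 1)) *\<^sub>R (x k - x (k - 1)))"

end

theory Submission
  imports Defs
begin

text \<open>Write \<open>v k\<close> for the objective gap at \<open>x k\<close>, and \<open>d k\<close>, \<open>w k\<close> for the squares of
  \<open>norm (x k - x (k - 1))\<close> and \<open>norm (x k - y k)\<close>, divided by twice the step size. The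
  forward-backward inequality gives
  \<open>v (k + 1) + d (k + 1) + (1 - \<mu>) * w (k + 1) \<le> v k + (\<gamma> k)\<^sup>2 * d k\<close>, so \<open>w\<close> tends to \<open>0\<close>, and
  then the error bound gives \<open>v k \<le> C * w k\<close> eventually. For weights \<open>S\<close> with
  \<open>S (k + 1) * (\<gamma> k)\<^sup>2 = S k\<close> and \<open>S (k + 1) / S k\<close> tending to \<open>1\<close>, the growth of the weight of \<open>v\<close>
  is therefore absorbed by the term in \<open>w\<close>, and \<open>S k * (v k + d k + (1 - \<mu>) * w k)\<close> is
  eventually decreasing with summable decrements of order \<open>S k * w k\<close>. Such weights are explicit
  and of order at least \<open>k ^ 6\<close>. Hence \<open>k ^ 6 * v k\<close> tends to \<open>0\<close> and \<open>k ^ 6 * d k\<close> is bounded; the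
  increments of \<open>x\<close> are then summable, with tails of order \<open>1 / k ^ 2\<close>.\<close>

section \<open>Lower semicontinuous convex functions and the proximal map\<close>

text \<open>\<open>Liminf (at x)\<close> sees only punctured neighbourhoods; the hypothesis
  \<open>a < g x\<close> supplies the centre.\<close>

lemma lsc_fun_eventually_less:
  assumes "lsc_fun g" "a < g x"
  shows "\<forall>\<^sub>F y in nhds x. a < g y"
  using assms unfolding lsc_fun_def le_Liminf_iff eventually_nhds_conv_at by blast

text \<open>Any \<open>a\<close> below \<open>g q\<close> is eventually below
  \<open>g (X n)\<close>, hence at most \<open>l\<close>. A convergent majorant \<open>b\<close> is
  used since the values \<open>g (X n)\<close> themselves need not converge.\<close>

lemma lsc_fun_le_limit:
  assumes lsc: "lsc_fun g" and X: "X \<longlonglongrightarrow> q"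
    and le: "\<forall>\<^sub>F n in sequentially. g (X n) \<le> ereal (b n)" and b: "b \<longlonglongrightarrow> l"
  shows "g q \<le> ereal l"
proof (rule dense_le)
  fix a assume "a < g q"
  then have "\<forall>\<^sub>F n in sequentially. a < g (X n)"
    using X lsc_fun_eventually_less[OF lsc] unfolding filterlim_iff by blast
  with le have "\<forall>\<^sub>F n in sequentially. a \<le> ereal (b n)"
    by eventually_elim auto
  moreover have "(\<lambda>n. ereal (b n)) \<longlonglongrightarrow> ereal l"
    using b by (simp add: lim_ereal)
  ultimately show "a \<le> ereal l"
    by (intro tendsto_lowerbound) auto
qed

section \<open>Convex functions with extended values and their real parts\<close>

locale proximable =
  fixes g :: "'a::{real_inner, complete_space} \<Rightarrow> ereal"
  assumes g_proper: "proper_fun g" and g_lsc: "lsc_fun g" and g_convex: "convex_fun g"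
begin

text \<open>Allows real arithmetic on the domain of \<open>g\<close>; where \<open>g\<close> is
  infinite, \<open>G\<close> has the default value 0 and carries no information.\<close>

definition G :: "'a \<Rightarrow> real" where "G x = real_of_ereal (g x)"

lemma g_eq: "g x \<noteq> \<infinity> \<Longrightarrow> g x = ereal (G x)"
  using g_proper by (cases "g x") (auto simp: G_def proper_fun_def)

lemma
  assumes "g x \<noteq> \<infinity>" "g y \<noteq> \<infinity>" "0 \<le> u" "u \<le> 1"
  shows g_convex_combination_finite: "g ((1 - u) *\<^sub>R x + u *\<^sub>R y) \<noteq> \<infinity>"
    and G_convex_combination_le:
      "G ((1 - u) *\<^sub>R x + u *\<^sub>R y) \<le> (1 - u) * G x + u * G y"
proof -
  have "g ((1 - u) *\<^sub>R x + u *\<^sub>R y) \<le> ereal (1 - u) * g x + ereal u * g y"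
    using g_convex assms(3,4) unfolding convex_fun_def by auto
  also have "\<dots> = ereal ((1 - u) * G x + u * G y)"
    using g_eq[OF assms(1)] g_eq[OF assms(2)] by simp
  finally have *: "g ((1 - u) *\<^sub>R x + u *\<^sub>R y) \<le> ereal ((1 - u) * G x + u * G y)" .
  then show fin: "g ((1 - u) *\<^sub>R x + u *\<^sub>R y) \<noteq> \<infinity>"
    by auto
  show "G ((1 - u) *\<^sub>R x + u *\<^sub>R y) \<le> (1 - u) * G x + u * G y"
    using * unfolding g_eq[OF fin] by simp
qed

text \<open>Semicontinuity gives a lower bound on a small ball around a point \<open>x0\<close> of the domain;
  convexity propagates it along the rays from \<open>x0\<close>.\<close>

lemma ex_norm_minorant:
  "\<exists>x0 r c. g x0 \<noteq> \<infinity> \<and> 0 \<le> c \<and> (\<forall>x. g x \<noteq> \<infinity> \<longrightarrow> r - c * norm (x - x0) \<le> G x)"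
proof -
  obtain x0 where x0: "g x0 \<noteq> \<infinity>"
    using g_proper unfolding proper_fun_def by blast
  have "ereal (G x0 - 1) < g x0"
    unfolding g_eq[OF x0] by simp
  from lsc_fun_eventually_less[OF g_lsc this]
  obtain \<delta> where \<delta>: "\<delta> > 0" and ball: "\<And>y. dist y x0 < \<delta> \<Longrightarrow> ereal (G x0 - 1) < g y"
    unfolding eventually_nhds_metric by blast
  have "(G x0 - 1) - (2 / \<delta>) * norm (x - x0) \<le> G x" if x: "g x \<noteq> \<infinity>" for x
  proof (cases "norm (x - x0) < \<delta>")
    case True
    then have "G x0 - 1 < G x"
      using ball[of x] by (simp add: dist_norm g_eq[OF x])
    moreover have "0 \<le> (2 / \<delta>) * norm (x - x0)"
      using \<delta> by simp
    ultimately show ?thesis by linarith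
  next
    case False
    define R where "R = norm (x - x0)"
    have R: "R \<ge> \<delta>" "R > 0"
      using False \<delta> by (auto simp: R_def)
    \<comment> \<open>This places \<open>?y\<close> on the segment from \<open>x0\<close> to
      \<open>x\<close> at distance \<open>\<delta> / 2\<close> from \<open>x0\<close>, inside the
      ball; hence the slope \<open>2 / \<delta>\<close>.\<close>
    define u where "u = \<delta> / (2 * R)"
    have u: "0 < u" "u \<le> 1"
      using R \<delta> by (auto simp: u_def field_simps)
    let ?y = "(1 - u) *\<^sub>R x0 + u *\<^sub>R x"
    have "?y - x0 = u *\<^sub>R (x - x0)"
      by (simp add: algebra_simps)
    then have "dist ?y x0 = u * R"
      using u by (simp add: dist_norm R_def)
    also have "\<dots> < \<delta>"
      using R \<delta> by (simp add: u_def)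
    finally have "ereal (G x0 - 1) < g ?y"
      by (rule ball)
    then have "G x0 - 1 < G ?y"
      using g_eq[OF g_convex_combination_finite[OF x0 x]] u by simp
    also have "\<dots> \<le> (1 - u) * G x0 + u * G x"
      using G_convex_combination_le[OF x0 x] u by simp
    finally have "u * (G x0 - G x) < 1"
      by (simp add: algebra_simps)
    then have "G x0 - G x < 1 / u"
      using u by (simp add: field_simps)
    also have "1 / u = (2 / \<delta>) * R"
      by (simp add: u_def)
    finally show ?thesis
      by (simp add: R_def)
  qed
  moreover have "0 \<le> 2 / \<delta>"
    using \<delta> by simp
  ultimately show ?thesis
    using x0 by blast
qed

section \<open>Existence and optimality of proximal points\<close>

context
  fixes lam :: real and z :: 'a
  assumes lam: "lam > 0"
begin

definition prox_objective :: "'a \<Rightarrow> ereal" where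
  "prox_objective x = g x + ereal (1 / (2 * lam) * (norm (x - z))\<^sup>2)"

text \<open>The minorant of \<open>G\<close> decreases only linearly in the norm, so the quadratic
  term dominates it.\<close>

lemma prox_objective_bounded_below:
  "\<exists>b. \<forall>x. g x \<noteq> \<infinity> \<longrightarrow> b \<le> G x + 1 / (2 * lam) * (norm (x - z))\<^sup>2"
proof -
  obtain x0 r c where x0: "g x0 \<noteq> \<infinity>" and c: "0 \<le> c"
    and G: "\<And>x. g x \<noteq> \<infinity> \<Longrightarrow> r - c * norm (x - x0) \<le> G x"
    using ex_norm_minorant by metis
  have "r - c * norm (z - x0) - lam * c\<^sup>2 / 2 \<le> G x + 1 / (2 * lam) * (norm (x - z))\<^sup>2"
    if x: "g x \<noteq> \<infinity>" for x
  proof -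
    define n where "n = norm (x - z)"
    have "norm (x - x0) \<le> n + norm (z - x0)"
      unfolding n_def using norm_triangle_ineq[of "x - z" "z - x0"] by simp
    then have "c * norm (x - x0) \<le> c * n + c * norm (z - x0)"
      using c by (metis mult_left_mono distrib_left)
    \<comment> \<open>Completing the square: \<open>n = lam * c\<close> is where the quadratic minus
      \<open>c * n\<close> is smallest.\<close>
    moreover have "0 \<le> (n - lam * c)\<^sup>2 / (2 * lam)"
      using lam by simp
    then have "c * n - lam * c\<^sup>2 / 2 \<le> 1 / (2 * lam) * n\<^sup>2"
      using lam by (simp add: power2_eq_square field_simps)
    ultimately show ?thesis
      using G[OF x] unfolding n_def by linarith
  qed
  then show ?thesis by blast
qed

text \<open>By the parallelogram law a minimizing sequence is Cauchy.\<close>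

lemma ex_prox: "\<exists>p. is_arg_min prox_objective (\<lambda>_. True) p"
proof -
  define \<phi> where "\<phi> x = G x + 1 / (2 * lam) * (norm (x - z))\<^sup>2" for x
  define D where "D = {x. g x \<noteq> \<infinity>}"
  define m where "m = Inf (\<phi> ` D)"
  have D: "D \<noteq> {}"
    using g_proper unfolding proper_fun_def D_def by blast
  have bdd: "bdd_below (\<phi> ` D)"
    using prox_objective_bounded_below unfolding \<phi>_def D_def bdd_below_def by auto
  have m_le: "m \<le> \<phi> x" if "x \<in> D" for x
    unfolding m_def using bdd that by (intro cInf_lower) auto
  have "\<exists>x\<in>D. \<phi> x < m + 1 / real (Suc n)" for n
    using cInf_lessD[of "\<phi> ` D" "m + 1 / real (Suc n)"] D unfolding m_def by auto
  then obtain X where XD: "\<And>n. X n \<in> D" and X: "\<And>n. \<phi> (X n) < m + 1 / real (Suc n)"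
    by metis
  have gap: "(norm (u - v))\<^sup>2 \<le> 4 * lam * ((\<phi> u - m) + (\<phi> v - m))"
    if "u \<in> D" "v \<in> D" for u v
  proof -
    define w where "w = (1 - 1/2) *\<^sub>R u + (1/2) *\<^sub>R v"
    have fin: "g u \<noteq> \<infinity>" "g v \<noteq> \<infinity>"
      using that by (auto simp: D_def)
    have "w \<in> D"
      using g_convex_combination_finite[OF fin, of "1/2"] unfolding D_def w_def by simp
    then have "m \<le> G w + 1 / (2 * lam) * (norm (w - z))\<^sup>2"
      using m_le by (simp add: \<phi>_def)
    moreover have "G w \<le> (G u + G v) / 2"
      using G_convex_combination_le[OF fin, of "1/2"] unfolding w_def by simp
    moreover have wz: "w - z = (1/2) *\<^sub>R ((u - z) + (v - z))"
      by (simp add: w_def algebra_simps flip: scaleR_add_left)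
    have norm_wz: "(norm (w - z))\<^sup>2
        = ((norm (u - z))\<^sup>2 + (norm (v - z))\<^sup>2) / 2 - (norm (u - v))\<^sup>2 / 4"
    proof -
      have "u - v = (u - z) - (v - z)" by simp
      then show ?thesis
        unfolding wz power2_norm_eq_inner
        by (simp add: inner_commute algebra_simps) argo
    qed
    have "1 / (2 * lam) * (norm (w - z))\<^sup>2
        = (1 / (2 * lam) * (norm (u - z))\<^sup>2 + 1 / (2 * lam) * (norm (v - z))\<^sup>2) / 2
          - (norm (u - v))\<^sup>2 / (8 * lam)"
      unfolding norm_wz using lam by (simp add: field_simps)
    ultimately have "m \<le> (\<phi> u + \<phi> v) / 2 - (norm (u - v))\<^sup>2 / (8 * lam)"
      unfolding \<phi>_def by argo
    then show ?thesis
      using lam by (simp add: field_simps)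
  qed
  have "Cauchy X"
  proof (rule CauchyI)
    fix e :: real assume e: "e > 0"
    \<comment> \<open>Two indices past \<open>N\<close> contribute at most \<open>2 / Suc N\<close>
      to the sum in \<open>gap\<close>, which has the factor \<open>4 * lam\<close>; hence
      \<open>8 * lam\<close>.\<close>
    obtain N where "1 / real (Suc N) < e\<^sup>2 / (8 * lam)"
      using nat_approx_posE[of "e\<^sup>2 / (8 * lam)"] e lam by auto
    then have N: "8 * lam * (1 / real (Suc N)) < e\<^sup>2"
      using lam by (simp add: field_simps)
    have near: "\<phi> (X n) - m \<le> 1 / real (Suc N)" if "n \<ge> N" for n
    proof -
      have "1 / real (Suc n) \<le> 1 / real (Suc N)"
        using that by (intro divide_left_mono) auto
      then show ?thesis
        using X[of n] by linarith
    qed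
    show "\<exists>M. \<forall>m\<ge>M. \<forall>n\<ge>M. norm (X m - X n) < e"
    proof (intro exI[of _ N] allI impI)
      fix i j assume "N \<le> i" "N \<le> j"
      then have "(\<phi> (X i) - m) + (\<phi> (X j) - m) \<le> 2 * (1 / real (Suc N))"
        using near[of i] near[of j] by linarith
      then have "4 * lam * ((\<phi> (X i) - m) + (\<phi> (X j) - m)) \<le> 4 * lam * (2 * (1 / real (Suc N)))"
        using lam by (intro mult_left_mono) auto
      then have "(norm (X i - X j))\<^sup>2 < e\<^sup>2"
        using gap[OF XD XD, of i j] N by linarith
      then show "norm (X i - X j) < e"
        using e by (simp add: power_less_imp_less_base)
    qed
  qed
  then obtain p where p: "X \<longlonglongrightarrow> p"
    by (auto simp: Cauchy_convergent_iff convergent_def)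
  \<comment> \<open>Moving the continuous quadratic term to the right leaves a convergent bound on
    \<open>g (X n)\<close> alone, to which semicontinuity applies.\<close>
  define b where "b n = m + 1 / real (Suc n) - 1 / (2 * lam) * (norm (X n - z))\<^sup>2" for n
  have gb: "g (X n) \<le> ereal (b n)" for n
    using X[of n] XD[of n] g_eq[of "X n"] unfolding b_def \<phi>_def D_def by simp
  have "b \<longlonglongrightarrow> m + 0 - 1 / (2 * lam) * (norm (p - z))\<^sup>2"
    unfolding b_def by (intro tendsto_intros lim_1_over_n[THEN LIMSEQ_Suc] p)
  from lsc_fun_le_limit[OF g_lsc p _ this] gb
  have gp: "g p \<le> ereal (m - 1 / (2 * lam) * (norm (p - z))\<^sup>2)"
    by simp
  have "prox_objective p \<le> prox_objective x" for x
  proof (cases "g x = \<infinity>")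
    case True
    then show ?thesis by (simp add: prox_objective_def)
  next
    case False
    have fin: "g p \<noteq> \<infinity>" using gp by auto
    have "m \<le> \<phi> x" using False m_le by (simp add: D_def)
    then show ?thesis
      using gp unfolding prox_objective_def g_eq[OF fin] g_eq[OF False] \<phi>_def by simp
  qed
  then show ?thesis
    by (auto simp: is_arg_min_def not_less)
qed

lemma prox_is_arg_min: "prox_objective (prox lam g z) \<le> prox_objective x"
proof -
  have "is_arg_min prox_objective (\<lambda>_. True) (prox lam g z)"
    unfolding prox_def arg_min_def prox_objective_def[abs_def, symmetric]
    using ex_prox by (rule someI_ex)
  then show ?thesis
    by (auto simp: is_arg_min_def not_less)
qed

lemma prox_finite: "g (prox lam g z) \<noteq> \<infinity>"
proof -
  obtain x where "g x \<noteq> \<infinity>"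
    using g_proper unfolding proper_fun_def by blast
  then show ?thesis
    using prox_is_arg_min[of x] g_eq[of x] unfolding prox_objective_def by auto
qed

text \<open>First-order optimality: \<open>(z - p) / lam\<close> is a subgradient of
  \<open>g\<close> at the proximal point \<open>p\<close>. Compare \<open>p\<close> with points on
  the segment towards \<open>x\<close>, divide by the step \<open>\<theta>\<close> and let it tend
  to 0.\<close>

lemma prox_variational_ineq:
  assumes x: "g x \<noteq> \<infinity>"
  shows "G (prox lam g z) + inner (z - prox lam g z) (x - prox lam g z) / lam \<le> G x"
proof -
  define p where "p = prox lam g z"
  have p: "g p \<noteq> \<infinity>"
    unfolding p_def by (rule prox_finite)
  have step: "G p + inner (z - p) (x - p) / lam - G x \<le> \<theta> * ((norm (x - p))\<^sup>2 / (2 * lam))"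
    if \<theta>: "0 < \<theta>" "\<theta> < 1" for \<theta> :: real
  proof -
    define w where "w = (1 - \<theta>) *\<^sub>R p + \<theta> *\<^sub>R x"
    have w: "g w \<noteq> \<infinity>"
      unfolding w_def using \<theta> by (intro g_convex_combination_finite p x) auto
    have wz: "w - z = (p - z) + \<theta> *\<^sub>R (x - p)"
      by (simp add: w_def algebra_simps)
    have norm_wz: "(norm (w - z))\<^sup>2
        = (norm (p - z))\<^sup>2 - 2 * \<theta> * inner (z - p) (x - p) + \<theta>\<^sup>2 * (norm (x - p))\<^sup>2"
      unfolding wz power2_norm_eq_inner
      by (simp add: inner_commute algebra_simps power2_eq_square)
    have "G p + 1 / (2 * lam) * (norm (p - z))\<^sup>2 \<le> G w + 1 / (2 * lam) * (norm (w - z))\<^sup>2"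
      using prox_is_arg_min[of w]
      unfolding prox_objective_def p_def[symmetric] g_eq[OF p] g_eq[OF w] by simp
    moreover have "G w \<le> (1 - \<theta>) * G p + \<theta> * G x"
      unfolding w_def using \<theta> by (intro G_convex_combination_le p x) auto
    ultimately have "G p + 1 / (2 * lam) * (norm (p - z))\<^sup>2 \<le> (1 - \<theta>) * G p + \<theta> * G x
        + 1 / (2 * lam) * (norm (w - z))\<^sup>2"
      by linarith
    also note norm_wz
    finally have "\<theta> * (G p + inner (z - p) (x - p) / lam - G x)
        \<le> \<theta> * (\<theta> * ((norm (x - p))\<^sup>2 / (2 * lam)))"
      using lam by (simp add: field_simps power2_eq_square)
    then show ?thesis
      using \<theta>(1) by (rule mult_left_le_imp_le)
  qed
  have "((\<lambda>\<theta>. \<theta> * ((norm (x - p))\<^sup>2 / (2 * lam))) \<longlongrightarrow> 0 * ((norm (x - p))\<^sup>2 / (2 * lam)))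
      (at_right 0)"
    by (intro tendsto_intros)
  moreover have "\<forall>\<^sub>F \<theta> in at_right 0.
      G p + inner (z - p) (x - p) / lam - G x \<le> \<theta> * ((norm (x - p))\<^sup>2 / (2 * lam))"
    using step by (auto simp: eventually_at_right_field intro: exI[of _ 1])
  ultimately have "G p + inner (z - p) (x - p) / lam - G x \<le> 0 * ((norm (x - p))\<^sup>2 / (2 * lam))"
    by (intro tendsto_lowerbound) auto
  then show ?thesis
    by (simp add: p_def)
qed

end

text \<open>Monotonicity of the subdifferential: test each variational inequality at the other
  proximal point and add.\<close>

lemma prox_nonexpansive:
  assumes lam: "lam > 0"
  shows "norm (prox lam g u - prox lam g v) \<le> norm (u - v)"
proof -
  define p q where "p = prox lam g u" and "q = prox lam g v"
  have "G p + inner (u - p) (q - p) / lam \<le> G q" "G q + inner (v - q) (p - q) / lam \<le> G p"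
    unfolding p_def q_def using lam by (auto intro!: prox_variational_ineq prox_finite)
  then have "inner (u - p) (q - p) / lam + inner (v - q) (p - q) / lam \<le> 0"
    by linarith
  then have "inner (u - p) (q - p) + inner (v - q) (p - q) \<le> 0"
    using lam by (simp add: field_simps)
  then have "(norm (p - q))\<^sup>2 \<le> inner (u - v) (p - q)"
    unfolding power2_norm_eq_inner by (simp add: inner_commute algebra_simps)
  also have "\<dots> \<le> norm (u - v) * norm (p - q)"
    by (rule norm_cauchy_schwarz)
  finally show ?thesis
    unfolding p_def[symmetric] q_def[symmetric] power2_eq_square
    by (cases "norm (p - q) = 0") auto
qed

end

section \<open>The forward-backward step\<close>

lemma GDERIV_line:
  assumes "\<And>z. GDERIV f z :> df z"
  shows "((\<lambda>s::real. f (y + s *\<^sub>R d)) has_real_derivative inner d (df (y + s *\<^sub>R d))) (at s)"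
proof -
  have "((\<lambda>s. y + s *\<^sub>R d) has_derivative (\<lambda>h. h *\<^sub>R d)) (at s)"
    by (auto intro!: derivative_eq_intros)
  from has_derivative_compose[OF this] assms[unfolded gderiv_def]
  have "((\<lambda>s. f (y + s *\<^sub>R d)) has_derivative (\<lambda>h. inner (h *\<^sub>R d) (df (y + s *\<^sub>R d)))) (at s)"
    by blast
  then show ?thesis
    unfolding has_field_derivative_def by (simp add: mult.commute[of _ "inner _ _"])
qed

lemma convex_gradient_ineq:
  assumes "convex_on UNIV f" and grad: "\<And>z. GDERIV f z :> df z"
  shows "f y + inner (df y) (x - y) \<le> f x"
proof -
  define \<phi> where "\<phi> s = f (y + s *\<^sub>R (x - y))" for s :: real
  have "convex_on UNIV \<phi>"
  proof (rule convex_onI)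
    fix u a b :: real assume u: "0 < u" "u < 1"
    have "y + ((1 - u) * a + u * b) *\<^sub>R (x - y)
        = (1 - u) *\<^sub>R (y + a *\<^sub>R (x - y)) + u *\<^sub>R (y + b *\<^sub>R (x - y))"
      by (simp add: algebra_simps)
    then show "\<phi> ((1 - u) *\<^sub>R a + u *\<^sub>R b) \<le> (1 - u) * \<phi> a + u * \<phi> b"
      using convex_onD[OF assms(1), of u "y + a *\<^sub>R (x - y)" "y + b *\<^sub>R (x - y)"] u
      by (simp add: \<phi>_def)
  qed simp
  moreover have "(\<phi> has_real_derivative inner (x - y) (df y)) (at 0)"
    using GDERIV_line[OF grad, of y "x - y" 0] unfolding \<phi>_def by simp
  ultimately have "inner (x - y) (df y) * (1 - 0) \<le> \<phi> 1 - \<phi> 0"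
    using convex_on_imp_above_tangent[of UNIV \<phi> 0 1] by simp
  then show ?thesis
    by (simp add: \<phi>_def inner_commute)
qed

text \<open>Along the segment, \<open>\<psi>\<close> is \<open>f\<close> minus its claimed quadratic
  bound, up to a constant. The Lipschitz condition makes its derivative nonpositive, so comparing
  the endpoints replaces integration.\<close>

lemma descent_lemma:
  assumes grad: "\<And>z. GDERIV f z :> df z" and lip: "L-lipschitz_on UNIV df"
  shows "f x \<le> f y + inner (df y) (x - y) + L / 2 * (norm (x - y))\<^sup>2"
proof -
  define d where "d = x - y"
  define \<psi> where "\<psi> s = f (y + s *\<^sub>R d) - s * inner (df y) d - L / 2 * s\<^sup>2 * (norm d)\<^sup>2" for s
  have deriv: "(\<psi> has_real_derivative
      inner d (df (y + s *\<^sub>R d)) - inner (df y) d - L * s * (norm d)\<^sup>2) (at s)" for s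
    unfolding \<psi>_def by (auto intro!: derivative_eq_intros GDERIV_line[OF grad])
  have "\<psi> 1 \<le> \<psi> 0"
  proof (rule DERIV_nonpos_imp_nonincreasing[where f = \<psi> and a = 0 and b = 1])
    fix s :: real assume s: "0 \<le> s" "s \<le> 1"
    have "inner d (df (y + s *\<^sub>R d) - df y) \<le> norm d * norm (df (y + s *\<^sub>R d) - df y)"
      by (rule norm_cauchy_schwarz)
    also have "\<dots> \<le> norm d * (L * (s * norm d))"
      using lipschitz_onD[OF lip, of "y + s *\<^sub>R d" y] s
      by (intro mult_left_mono) (auto simp: dist_norm)
    finally have "inner d (df (y + s *\<^sub>R d)) - inner (df y) d - L * s * (norm d)\<^sup>2 \<le> 0"
      by (simp add: inner_diff_right inner_commute power2_eq_square mult_ac)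
    with deriv show "\<exists>D. (\<psi> has_real_derivative D) (at s) \<and> D \<le> 0"
      by blast
  qed simp
  then show ?thesis
    by (simp add: \<psi>_def d_def)
qed

section \<open>Estimates for the forward-backward operator\<close>

locale composite_problem = proximable g
  for g :: "'a::{real_inner, complete_space} \<Rightarrow> ereal" +
  fixes f :: "'a \<Rightarrow> real" and df :: "'a \<Rightarrow> 'a" and L :: real
  assumes f_convex: "convex_on UNIV f" and f_gradient: "\<And>z. GDERIV f z :> df z"
    and L_pos: "L > 0" and gradient_lipschitz: "L-lipschitz_on UNIV df"
begin

abbreviation "T \<equiv> fb_step df g"

lemma fb_step_finite: "lam > 0 \<Longrightarrow> g (T lam y) \<noteq> \<infinity>"
  unfolding fb_step_def by (rule prox_finite)

lemma objective_eq: "g x \<noteq> \<infinity> \<Longrightarrow> objective f g x = ereal (f x + G x)"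
  unfolding objective_def by (subst g_eq) auto

lemma fb_step_variational_ineq:
  assumes lam: "lam > 0" and x: "g x \<noteq> \<infinity>"
  shows "G (T lam y) + inner (y - T lam y) (x - T lam y) / lam
    - inner (df y) (x - T lam y) \<le> G x"
  using prox_variational_ineq[OF lam x, of "y - lam *\<^sub>R df y"] lam
  unfolding fb_step_def[symmetric]
  by (simp add: inner_diff_left diff_divide_distrib add_divide_distrib algebra_simps)

text \<open>Adds the variational inequality, the gradient inequality from \<open>y\<close> to
  \<open>x\<close> and the descent lemma from \<open>y\<close> to \<open>T lam y\<close>; the inner
  product is then expanded into squares. The comparison point \<open>x\<close> is free: it will be
  the previous iterate for the energy and a near-closest minimizer for the error bound.\<close>

lemma fb_step_decrease:
  assumes lam: "lam > 0" and x: "g x \<noteq> \<infinity>"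
  shows "f (T lam y) + G (T lam y) + (norm (x - T lam y))\<^sup>2 / (2 * lam)
      + (1 - lam * L) * ((norm (T lam y - y))\<^sup>2 / (2 * lam))
    \<le> f x + G x + (norm (x - y))\<^sup>2 / (2 * lam)"
proof -
  define p where "p = T lam y"
  have "G p + inner (y - p) (x - p) / lam - inner (df y) (x - p) \<le> G x"
    unfolding p_def by (rule fb_step_variational_ineq[OF lam x])
  moreover have inner_eq: "inner (y - p) (x - p)
      = ((norm (x - p))\<^sup>2 + (norm (p - y))\<^sup>2 - (norm (x - y))\<^sup>2) / 2"
    unfolding power2_norm_eq_inner by (simp add: inner_commute algebra_simps)
  moreover have "f p \<le> f y + inner (df y) (p - y) + L / 2 * (norm (p - y))\<^sup>2"
    by (rule descent_lemma[OF f_gradient gradient_lipschitz])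
  moreover have "f y + inner (df y) (x - y) \<le> f x"
    by (rule convex_gradient_ineq[OF f_convex f_gradient])
  moreover have "inner (df y) (x - p) = inner (df y) (x - y) - inner (df y) (p - y)"
    by (simp add: algebra_simps)
  ultimately have "f p + G p
      + ((norm (x - p))\<^sup>2 + (norm (p - y))\<^sup>2 - (norm (x - y))\<^sup>2) / 2 / lam
      \<le> f x + G x + L / 2 * (norm (p - y))\<^sup>2"
    unfolding inner_eq by linarith
  moreover have "((norm (x - p))\<^sup>2 + (norm (p - y))\<^sup>2 - (norm (x - y))\<^sup>2) / 2 / lam
      = (norm (x - p))\<^sup>2 / (2 * lam) + (norm (p - y))\<^sup>2 / (2 * lam)
        - (norm (x - y))\<^sup>2 / (2 * lam)"
    by (simp add: add_divide_distrib diff_divide_distrib)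
  moreover have "(1 - lam * L) * ((norm (p - y))\<^sup>2 / (2 * lam))
      = (norm (p - y))\<^sup>2 / (2 * lam) - L / 2 * (norm (p - y))\<^sup>2"
    using lam by (simp add: field_simps)
  ultimately show ?thesis
    unfolding p_def[symmetric] by linarith
qed

lemma fb_step_lipschitz:
  assumes lam: "lam > 0"
  shows "norm (T lam u - T lam v) \<le> (1 + lam * L) * norm (u - v)"
proof -
  have "norm (T lam u - T lam v) \<le> norm ((u - v) - lam *\<^sub>R (df u - df v))"
    using prox_nonexpansive[OF lam, of "u - lam *\<^sub>R df u" "v - lam *\<^sub>R df v"]
    by (simp add: fb_step_def algebra_simps)
  also have "\<dots> \<le> norm (u - v) + lam * norm (df u - df v)"
    using norm_triangle_ineq4[of "u - v" "lam *\<^sub>R (df u - df v)"] lam by simp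
  also have "\<dots> \<le> norm (u - v) + lam * (L * norm (u - v))"
    using lipschitz_onD[OF gradient_lipschitz, of u v] lam by (simp add: dist_norm)
  finally show ?thesis
    by (simp add: algebra_simps)
qed

text \<open>Passes from the step size of the algorithm to the larger step \<open>1 / L\<close> of
  the error bound. Testing the two variational inequalities at each other's point cancels the
  gradient terms.\<close>

lemma fb_step_residual_mono:
  assumes lam: "lam > 0" and le: "lam \<le> lam'"
  shows "norm (T lam' x - x) \<le> lam' / lam * norm (T lam x - x)"
proof -
  define a b where "a = x - T lam x" and "b = x - T lam' x"
  have lam': "lam' > 0"
    using lam le by simp
  have "inner (x - T lam x) (T lam' x - T lam x) / lam
      + inner (x - T lam' x) (T lam x - T lam' x) / lam' \<le> 0"
    using fb_step_variational_ineq[OF lam fb_step_finite[OF lam'], of x x]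
      fb_step_variational_ineq[OF lam' fb_step_finite[OF lam], of x x]
    by (simp add: inner_diff_right)
  moreover have "T lam' x - T lam x = a - b" "T lam x - T lam' x = b - a"
    by (auto simp: a_def b_def)
  ultimately have "inner a (a - b) / lam + inner b (b - a) / lam' \<le> 0"
    unfolding a_def[symmetric] b_def[symmetric] by simp
  then have "lam' * inner a (a - b) + lam * inner b (b - a) \<le> 0"
    using lam lam' by (simp add: field_simps)
  then have "lam' * (norm a)\<^sup>2 + lam * (norm b)\<^sup>2 \<le> (lam + lam') * inner a b"
    unfolding power2_norm_eq_inner by (simp add: inner_commute algebra_simps)
  also have "\<dots> \<le> (lam + lam') * (norm a * norm b)"
    using lam lam' norm_cauchy_schwarz[of a b] by (intro mult_left_mono) auto
  \<comment> \<open>A nonpositive product confines \<open>norm b\<close> between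
    \<open>norm a\<close> and \<open>lam' / lam * norm a\<close>.\<close>
  finally have prod: "(norm b - norm a) * (lam * norm b - lam' * norm a) \<le> 0"
    by (simp add: algebra_simps power2_eq_square)
  have "lam * norm b \<le> lam' * norm a"
  proof (rule ccontr)
    assume *: "\<not> lam * norm b \<le> lam' * norm a"
    moreover have "lam * norm a \<le> lam' * norm a"
      using le by (simp add: mult_right_mono)
    ultimately have "lam * norm a < lam * norm b"
      by linarith
    then have "norm a < norm b"
      using lam by simp
    with * have "0 < (norm b - norm a) * (lam * norm b - lam' * norm a)"
      by simp
    with prod show False by simp
  qed
  then show ?thesis
    using lam by (simp add: a_def b_def norm_minus_commute field_simps)
qed

lemma
  assumes "p \<in> minimizers (objective f g)"
  shows minimizer_finite: "g p \<noteq> \<infinity>"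
    and minimizer_le: "g x \<noteq> \<infinity> \<Longrightarrow> f p + G p \<le> f x + G x"
proof -
  have le: "objective f g p \<le> objective f g x" for x
    using assms by (auto simp: minimizers_def is_arg_min_def not_less)
  obtain x0 where "g x0 \<noteq> \<infinity>"
    using g_proper unfolding proper_fun_def by blast
  then show fin: "g p \<noteq> \<infinity>"
    using le[of x0] objective_eq[of x0] by (auto simp: objective_def)
  show "f p + G p \<le> f x + G x" if "g x \<noteq> \<infinity>"
    using le[of x] objective_eq[OF fin] objective_eq[OF that] by simp
qed

text \<open>\<open>f\<close> is continuous and \<open>g\<close> lower semicontinuous, so the
  objective at \<open>q\<close> is at most the limit of the values, which is the minimum.\<close>

lemma limit_is_minimizer:
  assumes p: "p \<in> minimizers (objective f g)" and X: "X \<longlonglongrightarrow> q"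
    and fin: "\<forall>\<^sub>F n in sequentially. g (X n) \<noteq> \<infinity>"
    and lim: "(\<lambda>n. f (X n) + G (X n)) \<longlonglongrightarrow> f p + G p"
  shows "q \<in> minimizers (objective f g)"
proof -
  have "isCont f q"
    using f_gradient[of q] unfolding gderiv_def by (rule has_derivative_continuous)
  then have "(\<lambda>n. f (X n)) \<longlonglongrightarrow> f q"
    using X by (rule isCont_tendsto_compose)
  from tendsto_diff[OF lim this] have "(\<lambda>n. G (X n)) \<longlonglongrightarrow> f p + G p - f q"
    by simp
  moreover have "\<forall>\<^sub>F n in sequentially. g (X n) \<le> ereal (G (X n))"
    using fin by eventually_elim (simp add: g_eq)
  ultimately have gq: "g q \<le> ereal (f p + G p - f q)"
    by (intro lsc_fun_le_limit[OF g_lsc X])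
  then have "g q \<noteq> \<infinity>" by auto
  then have "objective f g q \<le> objective f g p"
    using gq g_eq[of q] by (simp add: objective_eq[OF minimizer_finite[OF p]] objective_eq)
  then show ?thesis
    using p unfolding minimizers_def is_arg_min_def by (auto simp: not_less dest: order_trans)
qed

text \<open>With \<open>x = T lam y\<close>, the residual at \<open>x\<close> for step
  \<open>lam\<close> is the difference of \<open>T lam x\<close> and \<open>T lam y\<close>, so the
  Lipschitz bound applies; 2 bounds \<open>1 + lam * L\<close>.\<close>

lemma fb_step_residual_le:
  assumes lam: "0 < lam" "lam * L \<le> 1"
  shows "norm (T (1 / L) (T lam y) - T lam y) \<le> 2 / (lam * L) * norm (T lam y - y)"
proof -
  define x where "x = T lam y"
  have "norm (T (1 / L) x - x) \<le> (1 / L) / lam * norm (T lam x - T lam y)"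
    using fb_step_residual_mono[OF lam(1), of "1 / L" x] lam(2) L_pos
    by (simp add: x_def field_simps)
  also have "\<dots> \<le> (1 / L) / lam * ((1 + lam * L) * norm (x - y))"
    using fb_step_lipschitz[OF lam(1)] lam(1) L_pos by (intro mult_left_mono) auto
  also have "\<dots> \<le> (1 / L) / lam * (2 * norm (x - y))"
    using lam L_pos by (intro mult_left_mono mult_right_mono) auto
  finally show ?thesis
    by (simp add: x_def mult.commute)
qed

text \<open>The error bound is applied at \<open>x = T lam y\<close>, where the objective is finite, and not
  at \<open>y\<close>.\<close>

lemma objective_gap_le_residual:
  assumes lam: "0 < lam" "lam * L \<le> 1" and \<tau>: "\<tau> > 0"
    and p: "p \<in> minimizers (objective f g)"
    and eb: "infdist (T lam y) (minimizers (objective f g))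
      \<le> \<tau> * norm (T (1 / L) (T lam y) - T lam y)"
  shows "f (T lam y) + G (T lam y) - (f p + G p)
    \<le> (\<tau> * (2 / (lam * L)) + 1)\<^sup>2 * ((norm (T lam y - y))\<^sup>2 / (2 * lam))"
proof -
  let ?X = "minimizers (objective f g)"
  define x where "x = T lam y"
  define n where "n = norm (x - y)"
  define C where "C = \<tau> * (2 / (lam * L)) + 1"
  have "infdist x ?X \<le> \<tau> * (2 / (lam * L) * n)"
    using eb fb_step_residual_le[OF lam, of y] \<tau> unfolding x_def n_def
    by (meson mult_left_mono order_trans less_imp_le)
  then have dist: "infdist x ?X + n \<le> C * n"
    by (simp add: C_def field_simps)
  \<comment> \<open>The distance to the minimizers is approximated up to \<open>\<delta>\<close>,
    which tends to 0 afterwards.\<close>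
  have "f x + G x - (f p + G p) \<le> (C * n + \<delta>)\<^sup>2 / (2 * lam)" if \<delta>: "\<delta> > 0" for \<delta>
  proof -
    have ne: "?X \<noteq> {}" using p by blast
    obtain q where q: "q \<in> ?X" "dist x q < infdist x ?X + \<delta>"
    proof -
      have "(INF a\<in>?X. dist x a) < infdist x ?X + \<delta>"
        using ne \<delta> by (simp add: infdist_def)
      then show ?thesis
        using ne that by (subst (asm) cINF_less_iff) auto
    qed
    have "norm (q - y) \<le> dist x q + n"
      using norm_triangle_ineq[of "q - x" "x - y"] by (simp add: n_def dist_norm norm_minus_commute)
    then have "norm (q - y) \<le> C * n + \<delta>"
      using q dist by linarith
    then have "(norm (q - y))\<^sup>2 \<le> (C * n + \<delta>)\<^sup>2"
      by (intro power_mono) auto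
    then have "(norm (q - y))\<^sup>2 / (2 * lam) \<le> (C * n + \<delta>)\<^sup>2 / (2 * lam)"
      using lam by (intro divide_right_mono) auto
    moreover have "f x + G x \<le> f q + G q + (norm (q - y))\<^sup>2 / (2 * lam)"
    proof -
      have "0 \<le> (norm (q - x))\<^sup>2 / (2 * lam)"
        "0 \<le> (1 - lam * L) * ((norm (x - y))\<^sup>2 / (2 * lam))"
        using lam by auto
      then show ?thesis
        using fb_step_decrease[OF lam(1) minimizer_finite[OF q(1)], of y]
        unfolding x_def[symmetric] by linarith
    qed
    moreover have "f q + G q \<le> f p + G p"
      by (rule minimizer_le[OF q(1) minimizer_finite[OF p]])
    ultimately show ?thesis by linarith
  qed
  then have "\<forall>\<^sub>F \<delta> in at_right 0. f x + G x - (f p + G p) \<le> (C * n + \<delta>)\<^sup>2 / (2 * lam)"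
    by (auto simp: eventually_at_right_field intro: exI[of _ 1])
  moreover have "((\<lambda>\<delta>. (C * n + \<delta>)\<^sup>2 / (2 * lam)) \<longlongrightarrow> (C * n + 0)\<^sup>2 / (2 * lam)) (at_right 0)"
    using lam by (intro tendsto_intros) auto
  ultimately have "f x + G x - (f p + G p) \<le> (C * n + 0)\<^sup>2 / (2 * lam)"
    by (intro tendsto_lowerbound) auto
  then show ?thesis
    by (simp add: x_def n_def C_def power_mult_distrib)
qed

end

section \<open>The inertial parameters\<close>

context
  fixes t :: "nat \<Rightarrow> real"
  assumes t_1: "t 1 = 1"
    and t_step: "\<And>k. k \<ge> 1 \<Longrightarrow> t (k + 1) = (1 + sqrt (1 + 4 * (t k)\<^sup>2)) / 2"
begin

lemma t_quadratic:
  assumes "k \<ge> 1"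
  shows "(t (k + 1))\<^sup>2 - t (k + 1) = (t k)\<^sup>2"
proof -
  have "((1 + s) / 2)\<^sup>2 - (1 + s) / 2 = (s\<^sup>2 - 1) / 4" for s :: real
    by (simp add: power2_eq_square field_simps)
  from this[of "sqrt (1 + 4 * (t k)\<^sup>2)"] show ?thesis
    unfolding t_step[OF assms] by simp
qed

lemma t_ge: "k \<ge> 1 \<Longrightarrow> t k \<ge> (real k + 1) / 2"
proof (induction k rule: dec_induct)
  case base
  then show ?case using t_1 by simp
next
  case (step k)
  have "2 * t k \<le> sqrt (1 + 4 * (t k)\<^sup>2)"
    by (rule real_le_rsqrt) (simp add: power_mult_distrib)
  then show ?case
    using step t_step[of k] by simp
qed

lemma t_ge_1: "k \<ge> 1 \<Longrightarrow> t k \<ge> 1"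
  using t_ge[of k] by simp

lemma t_Suc_le: "k \<ge> 1 \<Longrightarrow> t (k + 1) \<le> t k + 1"
proof -
  assume k: "k \<ge> 1"
  have "sqrt (1 + 4 * (t k)\<^sup>2) \<le> 1 + 2 * t k"
    using t_ge_1[OF k] by (intro real_le_lsqrt) (auto simp: power2_eq_square algebra_simps)
  then show ?thesis
    unfolding t_step[OF k] by simp
qed

lemma inertia_bounds:
  assumes k: "k \<ge> 1"
  shows "0 \<le> (t k - 1) / t (k + 1)" "(t k - 1) / t (k + 1) \<le> 1"
proof -
  have pos: "t k \<ge> 1" "t (k + 1) \<ge> 1"
    using t_ge_1 k by simp_all
  have "(t k)\<^sup>2 \<le> (t (k + 1))\<^sup>2"
    using t_quadratic[OF k] pos by linarith
  then have "t k \<le> t (k + 1)"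
    by (rule power2_le_imp_le) (use pos in linarith)
  then show "(t k - 1) / t (k + 1) \<le> 1"
    using pos by (simp add: divide_le_eq_1)
  show "0 \<le> (t k - 1) / t (k + 1)"
    using pos by simp
qed

text \<open>As \<open>t\<close> grows by at most 1 per step, the ratio is at least
  \<open>1 - 2 / t (k + 1)\<close>; linear growth of \<open>t\<close> does the rest.\<close>

lemma inertia_tendsto_1: "(\<lambda>k. (t k - 1) / t (k + 1)) \<longlonglongrightarrow> 1"
proof (rule tendsto_sandwich[where f = "\<lambda>k. 1 - 4 / real k" and h = "\<lambda>_. 1"])
  show "\<forall>\<^sub>F k in sequentially. 1 - 4 / real k \<le> (t k - 1) / t (k + 1)"
    using eventually_ge_at_top[of 1]
  proof eventually_elim
    case (elim k)
    have pos: "real k \<le> 2 * t (k + 1)" "t (k + 1) > 0"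
      using t_ge[of "k + 1"] by auto
    then have "4 / (2 * t (k + 1)) \<le> 4 / real k"
      using elim by (intro divide_left_mono) auto
    moreover have "4 / (2 * t (k + 1)) = 2 / t (k + 1)"
      by simp
    moreover have "1 - 2 / t (k + 1) \<le> (t k - 1) / t (k + 1)"
    proof -
      have "1 - 2 / t (k + 1) = (t (k + 1) - 2) / t (k + 1)"
        using pos by (simp add: diff_divide_distrib)
      also have "\<dots> \<le> (t k - 1) / t (k + 1)"
        using t_Suc_le[OF elim] pos by (intro divide_right_mono) auto
      finally show ?thesis .
    qed
    ultimately show ?case by argo
  qed
  show "\<forall>\<^sub>F k in sequentially. (t k - 1) / t (k + 1) \<le> 1"
    using eventually_ge_at_top[of 1] by eventually_elim (rule inertia_bounds)
  have "(\<lambda>k. 1 - 4 / real k) \<longlonglongrightarrow> 1 - 0"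
    by (intro tendsto_intros lim_const_over_n)
  then show "(\<lambda>k. 1 - 4 / real k) \<longlonglongrightarrow> 1" by simp
qed (rule tendsto_const)

text \<open>Since \<open>t k - 1 = (t (k - 1))\<^sup>2 / t k\<close>, the product of the inertial parameters telescopes; its
  inverse square is this weight up to a constant factor.\<close>

definition weight :: "nat \<Rightarrow> real" where
  "weight k = (t (k - 1)) ^ 4 * (t k)\<^sup>2"

text \<open>The denominator cancels against \<open>weight (k + 1)\<close>, and the recursion turns
  \<open>t k * (t k - 1)\<close> into the square of \<open>t (k - 1)\<close>. From
  \<open>k = 2\<close> on, the unconstrained \<open>t 0\<close> does not enter.\<close>

lemma weight_step:
  assumes "k \<ge> 2"
  shows "weight (k + 1) * ((t k - 1) / t (k + 1))\<^sup>2 = weight k"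
proof -
  have q: "(t k)\<^sup>2 - t k = (t (k - 1))\<^sup>2"
    using t_quadratic[of "k - 1"] assms by simp
  have "weight (k + 1) * ((t k - 1) / t (k + 1))\<^sup>2 = (t k) ^ 4 * (t k - 1)\<^sup>2"
    using t_ge_1[of "k + 1"] unfolding weight_def by (simp add: power_divide)
  also have "\<dots> = ((t k)\<^sup>2 - t k)\<^sup>2 * (t k)\<^sup>2"
    by algebra
  also have "\<dots> = weight k"
    unfolding q weight_def by simp
  finally show ?thesis .
qed

text \<open>Six factors, each at least \<open>k / 2\<close>: the source of the exponent 6 in the
  rate.\<close>

lemma weight_ge:
  assumes "k \<ge> 2"
  shows "real k ^ 6 / 64 \<le> weight k"
proof -
  have "(real k / 2) ^ 4 * (real k / 2)\<^sup>2 \<le> weight k"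
    using t_ge[of k] t_ge[of "k - 1"] assms unfolding weight_def
    by (intro mult_mono power_mono) auto
  then show ?thesis
    by (simp add: power_divide flip: power_add)
qed

lemma weight_mono:
  assumes "k \<ge> 2"
  shows "weight k \<le> weight (k + 1)"
proof -
  have "((t k - 1) / t (k + 1))\<^sup>2 \<le> 1"
    using inertia_bounds[of k] assms by (intro power_le_one) auto
  moreover have "0 \<le> weight (k + 1)"
    by (simp add: weight_def)
  ultimately have "weight (k + 1) * ((t k - 1) / t (k + 1))\<^sup>2 \<le> weight (k + 1)"
    by (rule mult_left_le)
  then show ?thesis
    unfolding weight_step[OF assms] .
qed

text \<open>By \<open>weight_step\<close> both sides are multiples of \<open>weight (k + 1)\<close>.
  The claim reduces to a comparison of \<open>1 - \<gamma>^2\<close> with \<open>\<gamma>^2\<close>,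
  decided by \<open>\<gamma>\<close> tending to 1.\<close>

lemma weight_growth:
  assumes c: "c > 0"
  shows "\<forall>\<^sub>F k in sequentially. (weight (k + 1) - weight k) * C \<le> c * weight k"
proof -
  define \<gamma> where "\<gamma> = (\<lambda>k. (t k - 1) / t (k + 1))"
  have \<gamma>: "\<gamma> \<longlonglongrightarrow> 1"
    unfolding \<gamma>_def by (rule inertia_tendsto_1)
  have "(\<lambda>k. c * (\<gamma> k)\<^sup>2 - (1 - (\<gamma> k)\<^sup>2) * C) \<longlonglongrightarrow> c * 1\<^sup>2 - (1 - 1\<^sup>2) * C"
    by (intro tendsto_intros \<gamma>)
  from order_tendstoD(1)[OF this, of 0]
  have "\<forall>\<^sub>F k in sequentially. 0 < c * (\<gamma> k)\<^sup>2 - (1 - (\<gamma> k)\<^sup>2) * C"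
    using c by simp
  then show ?thesis
    using eventually_ge_at_top[of 2]
  proof eventually_elim
    case (elim k)
    have w: "weight (k + 1) * (\<gamma> k)\<^sup>2 = weight k"
      unfolding \<gamma>_def by (rule weight_step[OF elim(2)])
    have "0 \<le> weight (k + 1) * (c * (\<gamma> k)\<^sup>2 - (1 - (\<gamma> k)\<^sup>2) * C)"
      using elim(1) by (intro mult_nonneg_nonneg) (simp_all add: weight_def)
    then have "(weight (k + 1) - weight (k + 1) * (\<gamma> k)\<^sup>2) * C
        \<le> c * (weight (k + 1) * (\<gamma> k)\<^sup>2)"
      by (simp add: algebra_simps)
    then show ?case
      unfolding w .
  qed
qed

end

section \<open>Energy decay and convergence rates\<close>

lemma nonneg_decrease_tendsto_0:
  fixes a b :: "nat \<Rightarrow> real"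
  assumes dec: "\<And>k. k \<ge> N \<Longrightarrow> a (k + 1) + b k \<le> a k"
    and a: "\<And>k. k \<ge> N \<Longrightarrow> 0 \<le> a k" and b: "\<And>k. k \<ge> N \<Longrightarrow> 0 \<le> b k"
  shows "b \<longlonglongrightarrow> 0"
proof -
  have sum_le: "(\<Sum>k<n. b (k + N)) + a (n + N) \<le> a N" for n
  proof (induction n)
    case (Suc n)
    then show ?case using dec[of "n + N"] by simp
  qed simp
  have "(\<Sum>k<n. b (k + N)) \<le> a N" for n
    using sum_le[of n] a[of "n + N"] by simp
  then have "summable (\<lambda>k. b (k + N))"
    using b by (intro summableI_nonneg_bounded) auto
  then show ?thesis
    by (intro LIMSEQ_offset[of b N] summable_LIMSEQ_zero)
qed

lemma nonneg_decrease_le: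
  fixes a b :: "nat \<Rightarrow> real"
  assumes dec: "\<And>k. k \<ge> N \<Longrightarrow> a (k + 1) + b k \<le> a k"
    and b: "\<And>k. k \<ge> N \<Longrightarrow> 0 \<le> b k" and k: "k \<ge> N"
  shows "a k \<le> a N"
  using k
proof (induction k rule: dec_induct)
  case (step k)
  then show ?case using dec[of k] b[of k] by simp
qed simp

lemma weighted_energy_decay:
  fixes v d w \<gamma> S :: "nat \<Rightarrow> real"
  assumes step: "\<And>k. k \<ge> N \<Longrightarrow> v (k + 1) + d (k + 1) + c * w (k + 1) \<le> v k + (\<gamma> k)\<^sup>2 * d k"
    and v: "\<And>k. k \<ge> N \<Longrightarrow> 0 \<le> v k" and d: "\<And>k. 0 \<le> d k" and w: "\<And>k. 0 \<le> w k"
    and gap: "\<And>k. k \<ge> N \<Longrightarrow> v k \<le> C * w k"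
    and S: "\<And>k. 0 \<le> S k" "\<And>k. k \<ge> N \<Longrightarrow> S k \<le> S (k + 1)"
      "\<And>k. k \<ge> N \<Longrightarrow> S (k + 1) * (\<gamma> k)\<^sup>2 \<le> S k"
      "\<And>k. k \<ge> N \<Longrightarrow> (S (k + 1) - S k) * C \<le> c / 2 * S k"
    and c: "c > 0"
  shows "(\<lambda>k. S k * w k) \<longlonglongrightarrow> 0" and "\<exists>B. \<forall>k\<ge>N. S k * d k \<le> B"
proof -
  define E where "E k = S k * (v k + d k + c * w k)" for k
  \<comment> \<open>One half of the residual term absorbs the growth of the weight of
    \<open>v\<close>; this other half survives as the decrement.\<close>
  define D where "D k = c / 2 * (S k * w k)" for k
  have dec: "E (k + 1) + D k \<le> E k" if k: "k \<ge> N" for k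
  proof -
    have "E (k + 1) \<le> S (k + 1) * (v k + (\<gamma> k)\<^sup>2 * d k)"
      unfolding E_def using step[OF k] S(1) by (rule mult_left_mono)
    also have "\<dots> = S k * v k + (S (k + 1) - S k) * v k + S (k + 1) * (\<gamma> k)\<^sup>2 * d k"
      by (simp add: algebra_simps)
    also have "\<dots> \<le> S k * v k + (S (k + 1) - S k) * (C * w k) + S k * d k"
      using k S(2,3) gap d by (intro add_mono mult_left_mono mult_right_mono order_refl) auto
    also have "(S (k + 1) - S k) * (C * w k) \<le> c / 2 * S k * w k"
      using mult_right_mono[OF S(4)[OF k] w[of k]] by (simp add: mult.assoc)
    finally show ?thesis
      unfolding E_def D_def by (simp add: algebra_simps)
  qed
  have D: "0 \<le> D k" for k
    using c S(1) w by (simp add: D_def)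
  have "0 \<le> E k" if "k \<ge> N" for k
    unfolding E_def using c S(1) v[OF that] d w by (intro mult_nonneg_nonneg add_nonneg_nonneg) auto
  then have "D \<longlonglongrightarrow> 0"
    by (intro nonneg_decrease_tendsto_0[of N E D] dec D)
  then have "(\<lambda>k. 2 / c * D k) \<longlonglongrightarrow> 2 / c * 0"
    by (intro tendsto_intros)
  then show "(\<lambda>k. S k * w k) \<longlonglongrightarrow> 0"
    using c by (simp add: D_def)
  have "S k * d k \<le> E N" if k: "k \<ge> N" for k
  proof -
    have "S k * d k \<le> E k"
      unfolding E_def using v[OF k] w[of k] c S(1) by (intro mult_left_mono) auto
    also have "\<dots> \<le> E N"
      using dec D k by (rule nonneg_decrease_le)
    finally show ?thesis .
  qed
  then show "\<exists>B. \<forall>k\<ge>N. S k * d k \<le> B" by blast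
qed

section \<open>From increments to convergence with a rate\<close>

lemma convergent_of_cubic_increments:
  fixes x :: "nat \<Rightarrow> 'a::{real_normed_vector, complete_space}"
  assumes N: "N \<ge> 1" and B: "B \<ge> 0"
    and incr: "\<And>k. k \<ge> N \<Longrightarrow> norm (x k - x (k - 1)) \<le> B / real k ^ 3"
  shows "\<exists>q. x \<longlonglongrightarrow> q \<and> (\<forall>k\<ge>N. norm (x k - q) \<le> B / (real k)\<^sup>2)"
proof -
  \<comment> \<open>The cubic bound on an increment is dominated by a telescoping difference of
    inverse squares.\<close>
  have tele: "norm (x m - x k) \<le> B * (1 / (real k)\<^sup>2 - 1 / (real m)\<^sup>2)" if "N \<le> k" "k \<le> m" for k m
    using that(2)
  proof (induction m rule: dec_induct)
    case (step m)
    have m: "real m > 0" using that(1) N step by auto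
    have "norm (x (Suc m) - x m) \<le> B * (1 / real (Suc m) ^ 3)"
      using incr[of "Suc m"] that(1) step by simp
    also have "1 / real (Suc m) ^ 3 \<le> 1 / (real m)\<^sup>2 - 1 / (real (Suc m))\<^sup>2"
    proof -
      have "1 / (real m)\<^sup>2 - 1 / (real (Suc m))\<^sup>2 - 1 / real (Suc m) ^ 3
          = (real m ^ 2 + 3 * real m + 1) / ((real m)\<^sup>2 * real (Suc m) ^ 3)"
        using m by (simp add: divide_simps) algebra
      moreover have "\<dots> \<ge> 0" by simp
      ultimately show ?thesis by linarith
    qed
    finally have "norm (x (Suc m) - x m) \<le> B * (1 / (real m)\<^sup>2 - 1 / (real (Suc m))\<^sup>2)"
      using B by (simp add: mult_left_mono)
    moreover have "norm (x (Suc m) - x k) \<le> norm (x (Suc m) - x m) + norm (x m - x k)"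
      using norm_triangle_ineq[of "x (Suc m) - x m" "x m - x k"] by simp
    ultimately show ?case
      using step by (simp add: algebra_simps)
  qed simp
  have bound: "norm (x m - x k) \<le> B / (real k)\<^sup>2" if "N \<le> k" "k \<le> m" for k m
  proof -
    have "B * (1 / (real k)\<^sup>2 - 1 / (real m)\<^sup>2) \<le> B * (1 / (real k)\<^sup>2)"
      using B by (intro mult_left_mono) auto
    with tele[OF that] show ?thesis by simp
  qed
  have "Cauchy x"
  proof (rule CauchyI)
    fix e :: real assume e: "e > 0"
    have "filterlim (\<lambda>k. (real k)\<^sup>2) at_infinity sequentially"
      by (intro filterlim_at_top_imp_at_infinity filterlim_pow_at_top filterlim_real_sequentially) simp
    then have "(\<lambda>k. B / (real k)\<^sup>2) \<longlonglongrightarrow> 0"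
      by (intro tendsto_divide_0[OF tendsto_const])
    then have "\<forall>\<^sub>F k in sequentially. B / (real k)\<^sup>2 < e / 2"
      using e by (intro order_tendstoD(2)) auto
    then have "\<forall>\<^sub>F k in sequentially. B / (real k)\<^sup>2 < e / 2 \<and> k \<ge> N"
      using eventually_ge_at_top[of N] by eventually_elim simp
    then obtain K where K: "B / (real K)\<^sup>2 < e / 2" "K \<ge> N"
      unfolding eventually_sequentially by blast
    show "\<exists>M. \<forall>m\<ge>M. \<forall>n\<ge>M. norm (x m - x n) < e"
    proof (intro exI[of _ K] allI impI)
      fix m n assume "K \<le> m" "K \<le> n"
      then have "norm (x m - x K) < e / 2" "norm (x n - x K) < e / 2"
        using bound[OF K(2)] K(1) by (meson le_less_trans)+
      then show "norm (x m - x n) < e"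
        using norm_triangle_ineq4[of "x m - x K" "x n - x K"] by simp
    qed
  qed
  then obtain q where q: "x \<longlonglongrightarrow> q"
    by (auto simp: Cauchy_convergent_iff convergent_def)
  have "norm (x k - q) \<le> B / (real k)\<^sup>2" if "k \<ge> N" for k
  proof (rule tendsto_upperbound)
    show "(\<lambda>m. norm (x k - x m)) \<longlonglongrightarrow> norm (x k - q)"
      by (intro tendsto_intros q)
    show "\<forall>\<^sub>F m in sequentially. norm (x k - x m) \<le> B / (real k)\<^sup>2"
      using eventually_ge_at_top[of k]
      by eventually_elim (use bound[OF that] in \<open>simp add: norm_minus_commute\<close>)
  qed simp
  with q show ?thesis by blast
qed

theorem corollary3p5:
  fixes f :: "'a::{real_inner, complete_space} \<Rightarrow> real"
    and df :: "'a \<Rightarrow> 'a"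
    and g :: "'a \<Rightarrow> ereal"
    and L \<mu> :: real
    and t :: "nat \<Rightarrow> real"
    and x y :: "nat \<Rightarrow> 'a"
    and xs :: 'a
  assumes f_convex: "convex_on UNIV f"
    and f_gradient: "\<And>z. GDERIV f z :> df z"
    and gradient_continuous: "continuous_on UNIV df"
    and L_pos: "L > 0"
    and gradient_lipschitz: "L-lipschitz_on UNIV df"
    and g_proper: "proper_fun g"
    and g_lsc: "lsc_fun g"
    and g_convex: "convex_fun g"
    and xs_min: "xs \<in> minimizers (objective f g)"
    and mu: "0 < \<mu>" "\<mu> < 1"
    and t_1: "t 1 = 1"
    and t_step: "\<And>k. k \<ge> 1 \<Longrightarrow> t (k + 1) = (1 + sqrt (1 + 4 * (t k)\<^sup>2)) / 2"
    and error_bound: "local_error_bound f df g L"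
    and algorithm: "inertial_fb df g (\<mu> / L) t x y"
  shows
    "(\<forall>\<^sub>F k in sequentially. objective f g (x k) \<noteq> \<infinity>) \<and>
     (\<lambda>k. real_of_ereal (objective f g (x k) - objective f g xs)) \<in> o(\<lambda>k. 1 / real k ^ 6) \<and>
     (\<lambda>k. norm (x k - x (k - 1))) \<in> O(\<lambda>k. 1 / real k ^ 3) \<and>
     (\<exists>xbar \<in> minimizers (objective f g).
        x \<longlonglongrightarrow> xbar \<and> (\<lambda>k. norm (x k - xbar)) \<in> O(\<lambda>k. 1 / real k ^ 2))"
proof -
  interpret composite_problem g f df L
    by unfold_locales fact+
  let ?X = "minimizers (objective f g)"
  define lam where "lam = \<mu> / L"
  define \<gamma> where "\<gamma> = (\<lambda>k. (t k - 1) / t (k + 1))"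
  define S where "S = weight t"
  \<comment> \<open>The start \<open>x 0\<close> may lie outside the domain of \<open>g\<close>, so
    \<open>v 0\<close> may be meaningless; the estimates begin at \<open>k = 1\<close>.\<close>
  define v where "v k = f (x k) + G (x k) - (f xs + G xs)" for k
  define d where "d k = (norm (x k - x (k - 1)))\<^sup>2 / (2 * lam)" for k
  define w where "w k = (norm (x k - y k))\<^sup>2 / (2 * lam)" for k
  have lam: "lam > 0" "lam * L = \<mu>"
    using mu L_pos by (auto simp: lam_def)
  have lamL: "lam * L \<le> 1"
    using lam mu by simp
  have x_eq: "x k = T lam (y k)" and y_eq: "y (k + 1) = x k + \<gamma> k *\<^sub>R (x k - x (k - 1))"
    if "k \<ge> 1" for k
    using algorithm that unfolding inertial_fb_def lam_def \<gamma>_def by blast+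
  have x_fin: "g (x k) \<noteq> \<infinity>" if "k \<ge> 1" for k
    unfolding x_eq[OF that] using lam(1) by (rule fb_step_finite)
  have v_nonneg: "0 \<le> v k" if "k \<ge> 1" for k
    using minimizer_le[OF xs_min x_fin[OF that]] by (simp add: v_def)
  have d_nonneg: "0 \<le> d k" and w_nonneg: "0 \<le> w k" for k
    using lam by (auto simp: d_def w_def)
  have \<gamma>_bounds: "0 \<le> \<gamma> k" "\<gamma> k \<le> 1" if "k \<ge> 1" for k
    unfolding \<gamma>_def using inertia_bounds[OF t_1 t_step that] by auto

  have step: "v (k + 1) + d (k + 1) + (1 - \<mu>) * w (k + 1) \<le> v k + (\<gamma> k)\<^sup>2 * d k"
    if k: "k \<ge> 1" for k
  proof -
    have x1: "x (k + 1) = T lam (y (k + 1))"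
      by (rule x_eq) simp
    have "x k - y (k + 1) = - (\<gamma> k *\<^sub>R (x k - x (k - 1)))"
      unfolding y_eq[OF k] by simp
    then have "(norm (x k - y (k + 1)))\<^sup>2 = (\<gamma> k)\<^sup>2 * (norm (x k - x (k - 1)))\<^sup>2"
      by (simp add: power_mult_distrib)
    then show ?thesis
      using fb_step_decrease[OF lam(1) x_fin[OF k], of "y (k + 1)"]
      unfolding x1[symmetric] lam(2) v_def d_def w_def
      by (simp add: norm_minus_commute)
  qed
  \<comment> \<open>This unweighted form comes first: it makes the residuals vanish and keeps the
    iterates in one sublevel set, as the error bound requires.\<close>
  have energy: "(v (k + 1) + d (k + 1)) + (1 - \<mu>) * w (k + 1) \<le> v k + d k"
    if k: "k \<ge> 1" for k
  proof -
    have "(\<gamma> k)\<^sup>2 * d k \<le> 1 * d k"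
      using \<gamma>_bounds[OF k] d_nonneg by (intro mult_right_mono power_le_one) auto
    then show ?thesis
      using step[OF k] by simp
  qed
  have "(\<lambda>k. (1 - \<mu>) * w (k + 1)) \<longlonglongrightarrow> 0"
    by (rule nonneg_decrease_tendsto_0[of 1 "\<lambda>k. v k + d k"])
      (use energy v_nonneg d_nonneg w_nonneg mu in auto)
  then have "(\<lambda>k. (1 / (1 - \<mu>)) * ((1 - \<mu>) * w (k + 1))) \<longlonglongrightarrow> (1 / (1 - \<mu>)) * 0"
    by (rule tendsto_mult[OF tendsto_const])
  then have "(\<lambda>k. w (k + 1)) \<longlonglongrightarrow> 0"
    using mu by simp
  then have w_lim: "w \<longlonglongrightarrow> 0"
    by (rule LIMSEQ_offset)
  have norm_xy: "norm (x k - y k) = sqrt (2 * lam * w k)" for k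
    using lam by (simp add: w_def real_sqrt_mult)
  have "(\<lambda>k. 2 / (lam * L) * sqrt (2 * lam * w k)) \<longlonglongrightarrow> 2 / (lam * L) * sqrt (2 * lam * 0)"
    by (intro tendsto_mult tendsto_real_sqrt tendsto_const w_lim)
  then have res_lim: "(\<lambda>k. 2 / (lam * L) * norm (x k - y k)) \<longlonglongrightarrow> 0"
    by (simp add: norm_xy)

  \<comment> \<open>The energy at \<open>k = 1\<close> fixes one level, hence one pair
    \<open>\<epsilon>\<close>, \<open>\<tau>\<close> for all iterates.\<close>
  define \<xi> where "\<xi> = v 1 + d 1 + (f xs + G xs)"
  have obj_le: "objective f g (x k) \<le> ereal \<xi>" if k: "k \<ge> 1" for k
  proof -
    have "v k + d k \<le> v 1 + d 1"
      by (rule nonneg_decrease_le[of 1 "\<lambda>k. v k + d k" "\<lambda>k. (1 - \<mu>) * w (k + 1)"])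
        (use energy w_nonneg mu k in auto)
    then show ?thesis
      using d_nonneg[of k] by (simp add: objective_eq[OF x_fin[OF k]] \<xi>_def v_def)
  qed
  have "(INF z. objective f g z) \<le> ereal \<xi>"
    using obj_le[of 1] by (auto intro: INF_lower2)
  then obtain \<epsilon> \<tau> where \<epsilon>: "\<epsilon> > 0" and \<tau>: "\<tau> > 0"
    and eb: "\<And>u. norm (T (1 / L) u - u) < \<epsilon> \<Longrightarrow> objective f g u \<le> ereal \<xi> \<Longrightarrow>
      infdist u ?X \<le> \<tau> * norm (T (1 / L) u - u)"
    using error_bound unfolding local_error_bound_def by metis
  define C where "C = (\<tau> * (2 / (lam * L)) + 1)\<^sup>2"
  have "\<forall>\<^sub>F k in sequentially. 2 / (lam * L) * norm (x k - y k) < \<epsilon>"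
    using order_tendstoD(2)[OF res_lim \<epsilon>] .
  then have gap: "\<forall>\<^sub>F k in sequentially. v k \<le> C * w k"
    using eventually_ge_at_top[of 1]
  proof eventually_elim
    case (elim k)
    have "norm (T (1 / L) (x k) - x k) < \<epsilon>"
      using fb_step_residual_le[OF lam(1) lamL, of "y k"] elim(1)
      unfolding x_eq[OF elim(2), symmetric] by linarith
    then have "infdist (x k) ?X \<le> \<tau> * norm (T (1 / L) (x k) - x k)"
      using obj_le[OF elim(2)] by (rule eb)
    then show ?case
      using objective_gap_le_residual[OF lam(1) lamL \<tau> xs_min, of "y k"]
      unfolding x_eq[OF elim(2), symmetric] v_def w_def C_def by simp
  qed
  have "\<forall>\<^sub>F k in sequentially. (S (k + 1) - S k) * C \<le> (1 - \<mu>) / 2 * S k"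
    unfolding S_def using mu by (intro weight_growth[OF t_1 t_step]) auto
  with gap obtain N0 where N0:
    "\<And>k. k \<ge> N0 \<Longrightarrow> v k \<le> C * w k \<and> (S (k + 1) - S k) * C \<le> (1 - \<mu>) / 2 * S k"
    unfolding eventually_sequentially by (metis max.bounded_iff)
  define N where "N = max 2 N0"
  have N: "N \<ge> 2" "N \<ge> N0" by (auto simp: N_def)
  have S_nonneg: "0 \<le> S k" for k
    by (simp add: S_def weight_def[OF t_1 t_step])
  have decay: "(\<lambda>k. S k * w k) \<longlonglongrightarrow> 0" "\<exists>B. \<forall>k\<ge>N. S k * d k \<le> B"
  proof -
    have S_step: "S (k + 1) * (\<gamma> k)\<^sup>2 \<le> S k" "S k \<le> S (k + 1)" if "k \<ge> N" for k
      using weight_step[OF t_1 t_step, of k] weight_mono[OF t_1 t_step, of k] that N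
      unfolding S_def \<gamma>_def by auto
    note * = weighted_energy_decay[of N v d "1 - \<mu>" w \<gamma> C S]
    show "(\<lambda>k. S k * w k) \<longlonglongrightarrow> 0"
      by (rule *(1)) (use step v_nonneg d_nonneg w_nonneg N0 N S_nonneg S_step mu in auto)
    show "\<exists>B. \<forall>k\<ge>N. S k * d k \<le> B"
      by (rule *(2)) (use step v_nonneg d_nonneg w_nonneg N0 N S_nonneg S_step mu in auto)
  qed
  have S_ge: "real k ^ 6 / 64 \<le> S k" if "k \<ge> N" for k
    unfolding S_def using that N by (intro weight_ge[OF t_1 t_step]) auto

  have v_lim: "(\<lambda>k. v k * real k ^ 6) \<longlonglongrightarrow> 0"
  proof (rule tendsto_sandwich[where f = "\<lambda>_. 0" and h = "\<lambda>k. 64 * C * (S k * w k)"])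
    show "\<forall>\<^sub>F k in sequentially. 0 \<le> v k * real k ^ 6"
      using eventually_ge_at_top[of 1] by eventually_elim (simp add: v_nonneg)
    show "\<forall>\<^sub>F k in sequentially. v k * real k ^ 6 \<le> 64 * C * (S k * w k)"
      using eventually_ge_at_top[of N]
    proof eventually_elim
      case (elim k)
      have "v k * real k ^ 6 \<le> (C * w k) * (64 * S k)"
        using N0[of k] S_ge[of k] N elim w_nonneg[of k]
        by (intro mult_mono) (auto simp: C_def)
      then show ?case by (simp add: mult_ac)
    qed
    have "(\<lambda>k. 64 * C * (S k * w k)) \<longlonglongrightarrow> 64 * C * 0"
      by (intro tendsto_mult tendsto_const decay(1))
    then show "(\<lambda>k. 64 * C * (S k * w k)) \<longlonglongrightarrow> 0" by simp
  qed simp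
  have v_eq: "real_of_ereal (objective f g (x k) - objective f g xs) = v k" if "k \<ge> 1" for k
    by (simp add: objective_eq[OF x_fin[OF that]] objective_eq[OF minimizer_finite[OF xs_min]] v_def)

  have fin: "\<forall>\<^sub>F k in sequentially. objective f g (x k) \<noteq> \<infinity>"
    using eventually_ge_at_top[of 1]
    by eventually_elim (simp add: objective_eq[OF x_fin])
  have gap_rate: "(\<lambda>k. real_of_ereal (objective f g (x k) - objective f g xs))
      \<in> o(\<lambda>k. 1 / real k ^ 6)"
  proof (rule smalloI_tendsto)
    show "\<forall>\<^sub>F k in sequentially. 1 / real k ^ 6 \<noteq> 0"
      using eventually_ge_at_top[of 1] by eventually_elim simp
    have "\<forall>\<^sub>F k in sequentially. v k * real k ^ 6
        = real_of_ereal (objective f g (x k) - objective f g xs) / (1 / real k ^ 6)"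
      using eventually_ge_at_top[of 1] by eventually_elim (simp add: v_eq)
    then show "(\<lambda>k. real_of_ereal (objective f g (x k) - objective f g xs) / (1 / real k ^ 6))
        \<longlonglongrightarrow> 0"
      using v_lim by (rule Lim_transform_eventually[rotated])
  qed

  obtain B where B: "\<And>k. k \<ge> N \<Longrightarrow> S k * d k \<le> B"
    using decay(2) by blast
  \<comment> \<open>The factor 128 combines 64 from \<open>S_ge\<close> with the 2 in the
    denominator of \<open>d\<close>.\<close>
  define K where "K = sqrt (128 * lam * B)"
  have incr: "norm (x k - x (k - 1)) \<le> K / real k ^ 3" if k: "k \<ge> N" for k
  proof -
    have pos: "real k > 0" using k N by simp
    have "real k ^ 6 / 64 * d k \<le> B"
      using mult_right_mono[OF S_ge[OF k] d_nonneg[of k]] B[OF k] by linarith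
    then have "(norm (x k - x (k - 1)) * real k ^ 3)\<^sup>2 \<le> 128 * lam * B"
      using lam(1) by (simp add: d_def field_simps power_mult_distrib flip: power_mult)
    then have "norm (x k - x (k - 1)) * real k ^ 3 \<le> K"
      unfolding K_def by (rule real_le_rsqrt)
    then show ?thesis
      using pos by (simp add: field_simps)
  qed
  \<comment> \<open>\<open>sqrt\<close> is negative at negative arguments and the sign of
    \<open>B\<close> is not recorded, so \<open>K \<ge> 0\<close> is read off from the increment at
    \<open>N\<close>.\<close>
  have "0 \<le> norm (x N - x (N - 1)) * real N ^ 3"
    by simp
  also have "\<dots> \<le> K"
    using incr[of N] N by (simp add: field_simps)
  finally have K: "K \<ge> 0" .
  have incr_rate: "(\<lambda>k. norm (x k - x (k - 1))) \<in> O(\<lambda>k. 1 / real k ^ 3)"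
    by (rule bigoI[of _ K]) (use incr in \<open>auto simp: eventually_sequentially\<close>)

  obtain q where q: "x \<longlonglongrightarrow> q" and q_rate: "\<And>k. k \<ge> N \<Longrightarrow> norm (x k - q) \<le> K / (real k)\<^sup>2"
    using convergent_of_cubic_increments[of N K x] N K incr by auto
  have iter_rate: "(\<lambda>k. norm (x k - q)) \<in> O(\<lambda>k. 1 / real k ^ 2)"
    by (rule bigoI[of _ K]) (use q_rate in \<open>auto simp: eventually_sequentially\<close>)
  \<comment> \<open>The gap bound forces the objective values to the minimum, which identifies
    \<open>q\<close> as a minimizer.\<close>
  have "(\<lambda>k. C * w k) \<longlonglongrightarrow> C * 0"
    by (intro tendsto_mult tendsto_const w_lim)
  then have "v \<longlonglongrightarrow> 0"
    using gap v_nonneg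
    by (intro tendsto_sandwich[where f = "\<lambda>_. 0" and h = "\<lambda>k. C * w k" and g = v])
      (auto simp: eventually_sequentially)
  then have "(\<lambda>k. v k + (f xs + G xs)) \<longlonglongrightarrow> 0 + (f xs + G xs)"
    by (intro tendsto_add tendsto_const)
  then have "(\<lambda>k. f (x k) + G (x k)) \<longlonglongrightarrow> f xs + G xs"
    by (simp add: v_def)
  moreover have "\<forall>\<^sub>F k in sequentially. g (x k) \<noteq> \<infinity>"
    using eventually_ge_at_top[of 1] by eventually_elim (rule x_fin)
  ultimately have "q \<in> ?X"
    using limit_is_minimizer[OF xs_min q] by blast
  with fin gap_rate incr_rate q iter_rate show ?thesis
    by blast
qed

end
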